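(* If $X$ is any linearly Lindelöf regular space of countable tightness, then $\ell L(X_\delta) \le L(X_\delta) \le \varrho(\mathfrak{c})$. In particular, if $\mathfrak{c} = 2^{<\mathfrak{c}}$ then $\ell L(X_\delta) \le L(X_\delta) \le \mathfrak{c}$.
   Context: Regular spaces are assumed to be Hausdorff. A point $p$ is a complete accumulation point of a set $A$ in a space $Y$ if $|U \cap A| = |A|$ for every neighbourhood $U$ of $p$. A space $X$ is linearly Lindelöf if every subset of $X$ of uncountable regular cardinality has a complete accumulation point in $X$ (equivalently, every open cover of $X$ that is linearly ordered by inclusion has a countable subcover). The linear Lindelöf number $\ell L(Y)$ of a space $Y$ is the smallest infinite cardinal $\lambda$ such that every subset of $Y$ of regular cardinality $> \lambda$ has a complete accumulation point in $Y$. $X$ has countable tightness if whenever $x \in \overline{A}$ with $A \subset X$, there is a countable $B \subset A$ with $x \in \overline{B}$. $X_\delta$ is the $G_\delta$-modification of $X$: the set $X$ with the topology generated by all $G_\delta$-sets of $X$. $L(Y)$ is the Lindelöf number of a space $Y$: the smallest infinite cardinal $\lambda$ such that every open cover of $Y$ has a subcover of size $\le \lambda$. $\mathfrak{c} = 2^{\omega}$. For cardinals $\varrho,\kappa$, $\varrho^{<\kappa} = \sup\{\varrho^{\nu} : \nu < \kappa,\ \nu \text{ a cardinal}\}$. For an uncountable cardinal $\kappa$, $\varrho(\kappa)$ is the smallest infinite cardinal $\varrho$ such that $\varrho^{<\kappa} = \varrho$. *)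

theory Defs
  imports "HOL-Analysis.Analysis"
begin

unbundle cardinal_syntax

(* Set_Algebras uses the same symbol for set membership. *)
no_notation (input) elt_set_eq (infix \<open>=o\<close> 50)

text \<open>
  Cardinals are the \<^const>\<open>Card_order\<close> relations of the library, compared across types by
  \<open>\<le>o\<close>, \<open><o\<close> and \<open>=o\<close>; equality of cardinals is \<open>=o\<close>. Each type houses only boundedly many of
  them, so every minimum below is taken on a type that is large enough for the minimum to exist.
  The lemmas show this, and show that the minimum is then also a minimum over the cardinals
  on any other type.
\<close>

definition card_Least :: "('a rel \<Rightarrow> bool) \<Rightarrow> 'a rel" where
  "card_Least P = (SOME r. Card_order r \<and> P r \<and> (\<forall>r'. Card_order r' \<and> P r' \<longrightarrow> r \<le>o r'))"

lemma card_Least_works: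
  assumes "Card_order r0" "P r0"
  shows "Card_order (card_Least P) \<and> P (card_Least P)
    \<and> (\<forall>r'. Card_order r' \<and> P r' \<longrightarrow> card_Least P \<le>o r')"
proof -
  have "\<exists>r\<in>{r. Card_order r \<and> P r}. \<forall>r'\<in>{r. Card_order r \<and> P r}. r \<le>o r'"
    by (rule exists_minim_Card_order) (use assms in auto)
  then have "\<exists>r. Card_order r \<and> P r \<and> (\<forall>r'. Card_order r' \<and> P r' \<longrightarrow> r \<le>o r')"
    by blast
  then show ?thesis
    unfolding card_Least_def by (rule someI_ex)
qed

lemma card_Least_le:
  fixes s :: "'b rel"
  assumes ex: "Card_order r0" "P r0"
    and s: "Card_order s" "\<And>p. Card_order p \<Longrightarrow> s =o p \<Longrightarrow> P p"
  shows "card_Least P \<le>o s"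
proof (rule ccontr)
  note least = card_Least_works[of r0 P, OF ex]
  assume "\<not> card_Least P \<le>o s"
  then have less: "s <o card_Least P"
    using least s(1) by (auto simp: card_order_on_def dest: not_ordLeq_iff_ordLess)
  obtain p :: "'a rel" where p: "s =o p" "p <o card_Least P"
    using internalize_ordLess[THEN iffD1, OF less] by blast
  then have "Card_order p"
    using s(1) Card_order_ordIso2 by blast
  then have "card_Least P \<le>o p"
    using s(2) p(1) least by blast
  then show False
    using p(2) not_ordLess_ordLeq by blast
qed

lemma Card_order_ordLeq_UNIV: "Card_order (r :: 'a rel) \<Longrightarrow> r \<le>o |UNIV :: 'a set|"
  using card_of_Field_ordIso card_of_mono1[of "Field r" UNIV] ordIso_ordLeq_trans
    ordIso_symmetric by blast

definition card_Sup :: "'a rel set \<Rightarrow> 'a rel" where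
  "card_Sup R = card_Least (\<lambda>s. \<forall>r\<in>R. r \<le>o s)"

lemma card_Sup_upper:
  fixes R :: "'a rel set"
  assumes "\<forall>r\<in>R. Card_order r"
  shows "Card_order (card_Sup R) \<and> (\<forall>r\<in>R. r \<le>o card_Sup R)"
proof -
  have "\<forall>r\<in>R. r \<le>o |UNIV :: 'a set|"
    by (intro ballI Card_order_ordLeq_UNIV) (use assms in blast)
  from card_Least_works[of "|UNIV :: 'a set|" "\<lambda>s. \<forall>r\<in>R. r \<le>o s", OF card_of_Card_order this]
  show ?thesis unfolding card_Sup_def by blast
qed

lemma card_Sup_least:
  fixes R :: "'a rel set" and s :: "'b rel"
  assumes "\<forall>r\<in>R. Card_order r" "Card_order s" "\<forall>r\<in>R. r \<le>o s"
  shows "card_Sup R \<le>o s"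
  unfolding card_Sup_def
proof (rule card_Least_le)
  show "Card_order |UNIV :: 'a set|" by (rule card_of_Card_order)
  show "\<forall>r\<in>R. r \<le>o |UNIV :: 'a set|"
    by (intro ballI Card_order_ordLeq_UNIV) (use assms in blast)
  show "Card_order s" by fact
  show "\<forall>r\<in>R. r \<le>o p" if "s =o p" for p :: "'a rel"
    using assms(3) that ordLeq_ordIso_trans by blast
qed

text \<open>Every cardinal below \<open>\<kappa>\<close> has a representative on the type of \<open>\<kappa>\<close>.\<close>

definition cpow_less :: "'r rel \<Rightarrow> 'k rel \<Rightarrow> ('k \<Rightarrow> 'r) rel" where
  "cpow_less \<rho> \<kappa> = card_Sup {\<rho> ^c \<nu> | \<nu> :: 'k rel. Card_order \<nu> \<and> \<nu> <o \<kappa>}"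

lemma cpow_less_upper:
  fixes \<nu> :: "'b rel" and \<rho> :: "'r rel" and \<kappa> :: "'k rel"
  assumes "Card_order \<nu>" "\<nu> <o \<kappa>" "Card_order \<rho>"
  shows "\<rho> ^c \<nu> \<le>o cpow_less \<rho> \<kappa>"
proof -
  obtain p :: "'k rel" where p: "\<nu> =o p" "p <o \<kappa>"
    using internalize_ordLess[THEN iffD1, OF assms(2)] by blast
  then have "Card_order p"
    using assms(1) Card_order_ordIso2 by blast
  moreover from this have "\<rho> ^c \<nu> =o \<rho> ^c p"
    using p(1) assms by (intro cexp_cong2)
  moreover have "\<forall>r\<in>{\<rho> ^c \<nu> | \<nu>. Card_order \<nu> \<and> \<nu> <o \<kappa>}. Card_order r"
    using Card_order_cexp by blast
  ultimately show ?thesis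
    using card_Sup_upper[of "{\<rho> ^c \<nu> | \<nu>. Card_order \<nu> \<and> \<nu> <o \<kappa>}"] p(2)
      ordIso_ordLeq_trans unfolding cpow_less_def by blast
qed

lemma cpow_less_least:
  fixes \<rho> :: "'r rel" and \<kappa> :: "'k rel" and \<sigma> :: "'b rel"
  assumes "Card_order \<sigma>"
    and "\<And>\<nu> :: 'k rel. Card_order \<nu> \<Longrightarrow> \<nu> <o \<kappa> \<Longrightarrow> \<rho> ^c \<nu> \<le>o \<sigma>"
  shows "cpow_less \<rho> \<kappa> \<le>o \<sigma>"
  unfolding cpow_less_def
  by (rule card_Sup_least) (use assms Card_order_cexp in auto)

lemma Card_order_cpow_less: "Card_order (cpow_less \<rho> \<kappa>)"
  unfolding cpow_less_def using card_Sup_upper[of "{\<rho> ^c \<nu> | \<nu>. Card_order \<nu> \<and> \<nu> <o \<kappa>}"]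
    Card_order_cexp by blast

text \<open>
  Since \<open>2 ^ \<kappa>\<close> satisfies the defining equation, the least solution \<open>\<rho>(\<kappa>)\<close>
  lives on the powerset of the type of \<open>\<kappa>\<close>.
\<close>

definition rho :: "'k rel \<Rightarrow> 'k set rel" where
  "rho \<kappa> = card_Least (\<lambda>\<rho>. cinfinite \<rho> \<and> cpow_less \<rho> \<kappa> =o \<rho>)"

lemma cpow_less_fixI:
  fixes \<rho> :: "'r rel" and \<kappa> :: "'k rel"
  assumes "Cinfinite \<rho>" "Cinfinite \<kappa>"
    and "\<And>\<nu> :: 'k rel. Card_order \<nu> \<Longrightarrow> \<nu> <o \<kappa> \<Longrightarrow> \<rho> ^c \<nu> \<le>o \<rho>"
  shows "cpow_less \<rho> \<kappa> =o \<rho>"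
proof -
  have "cone <o \<kappa>"
    using assms(2) Cfinite_cone Cfinite_ordLess_Cinfinite by blast
  then have "\<rho> ^c cone \<le>o cpow_less \<rho> \<kappa>"
    using assms(1) Card_order_cone by (intro cpow_less_upper) auto
  moreover have "\<rho> =o \<rho> ^c cone"
    using assms(1) cexp_cone ordIso_symmetric by blast
  ultimately have "\<rho> \<le>o cpow_less \<rho> \<kappa>"
    using ordIso_ordLeq_trans by blast
  moreover have "cpow_less \<rho> \<kappa> \<le>o \<rho>"
    using assms by (intro cpow_less_least) auto
  ultimately show ?thesis
    by (simp add: ordIso_iff_ordLeq)
qed

lemma rho_solution_exists:
  fixes \<kappa> :: "'k rel"
  assumes "Cinfinite \<kappa>"
  shows "cinfinite |Pow (Field \<kappa>)| \<and> cpow_less ( |Pow (Field \<kappa>)| ) \<kappa> =o |Pow (Field \<kappa>)|"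
proof -
  let ?\<rho> = "|Pow (Field \<kappa>)|"
  have inf: "cinfinite ?\<rho>"
    using assms by (simp add: cinfinite_def Field_card_of)
  have eq: "?\<rho> =o ctwo ^c \<kappa>"
    unfolding cexp_def ctwo_def Field_card_of by (rule card_of_Pow_Func)
  have "?\<rho> ^c \<nu> \<le>o ?\<rho>" if \<nu>: "Card_order \<nu>" "\<nu> <o \<kappa>" for \<nu> :: "'k rel"
  proof (cases "Field \<nu> = {}")
    case True
    have "?\<rho> ^c \<nu> = |{\<lambda>x. undefined :: 'k set}|"
      unfolding cexp_def True by (simp add: Func_empty)
    also have "\<dots> \<le>o ?\<rho>"
      by (rule card_of_singl_ordLeq) auto
    finally show ?thesis .
  next
    case False
    then have "Cnotzero \<nu>"
      using \<nu>(1) czeroE by blast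
    have "?\<rho> ^c \<nu> =o (ctwo ^c \<kappa>) ^c \<nu>"
      using eq \<nu>(1) by (rule cexp_cong1)
    also have "(ctwo ^c \<kappa>) ^c \<nu> =o ctwo ^c \<kappa>"
      using Card_order_ctwo assms \<open>Cnotzero \<nu>\<close> ordLess_imp_ordLeq[OF \<nu>(2)]
      by (rule cexp_cprod_ordLeq)
    also have "ctwo ^c \<kappa> =o ?\<rho>"
      using eq by (rule ordIso_symmetric)
    finally show ?thesis
      by (rule ordIso_imp_ordLeq)
  qed
  then show ?thesis
    using cpow_less_fixI[of ?\<rho> \<kappa>] inf assms card_of_Card_order by blast
qed


lemma rho_works:
  assumes "Cinfinite \<kappa>"
  shows "Cinfinite (rho \<kappa>)" "cpow_less (rho \<kappa>) \<kappa> =o rho \<kappa>"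
  using card_Least_works[of "|Pow (Field \<kappa>)|" "\<lambda>\<rho>. cinfinite \<rho> \<and> cpow_less \<rho> \<kappa> =o \<rho>"]
    rho_solution_exists[OF assms] card_of_Card_order unfolding rho_def by blast+

lemma cpow_less_mono1:
  fixes \<rho> :: "'r rel" and \<rho>' :: "'s rel" and \<kappa> :: "'k rel"
  assumes "\<rho> \<le>o \<rho>'" "Card_order \<rho>'"
  shows "cpow_less \<rho> \<kappa> \<le>o cpow_less \<rho>' \<kappa>"
proof (rule cpow_less_least)
  show "Card_order (cpow_less \<rho>' \<kappa>)" by (rule Card_order_cpow_less)
  fix \<nu> :: "'k rel"
  assume \<nu>: "Card_order \<nu>" "\<nu> <o \<kappa>"
  show "\<rho> ^c \<nu> \<le>o cpow_less \<rho>' \<kappa>"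
    using cexp_mono1[OF assms(1) \<nu>(1)] cpow_less_upper[OF \<nu> assms(2)]
    by (rule ordLeq_transitive)
qed

lemma cpow_less_cong1:
  fixes \<rho> :: "'r rel" and \<rho>' :: "'s rel" and \<kappa> :: "'k rel"
  assumes "\<rho> =o \<rho>'" "Card_order \<rho>" "Card_order \<rho>'"
  shows "cpow_less \<rho> \<kappa> =o cpow_less \<rho>' \<kappa>"
  using assms cpow_less_mono1[of \<rho> \<rho>' \<kappa>] cpow_less_mono1[of \<rho>' \<rho> \<kappa>]
  by (simp add: ordIso_iff_ordLeq)

lemma rho_le:
  fixes \<kappa> :: "'a rel" and \<sigma> :: "'b rel"
  assumes "Cinfinite \<kappa>" "Cinfinite \<sigma>" "cpow_less \<sigma> \<kappa> =o \<sigma>"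
  shows "rho \<kappa> \<le>o \<sigma>"
  unfolding rho_def
proof (rule card_Least_le)
  show "Card_order |Pow (Field \<kappa>)|" by (rule card_of_Card_order)
  show "cinfinite |Pow (Field \<kappa>)| \<and> cpow_less ( |Pow (Field \<kappa>)| ) \<kappa> =o |Pow (Field \<kappa>)|"
    using assms(1) by (rule rho_solution_exists)
  show "Card_order \<sigma>" using assms by blast
  show "cinfinite p \<and> cpow_less p \<kappa> =o p" if "Card_order p" "\<sigma> =o p" for p :: "'a set rel"
  proof
    show "cinfinite p" using that assms(2) Cinfinite_cong by blast
    have "cpow_less p \<kappa> =o cpow_less \<sigma> \<kappa>"
      using that assms(2) by (intro cpow_less_cong1) (auto intro: ordIso_symmetric)
    then show "cpow_less p \<kappa> =o p"
      using ordIso_transitive[OF _ ordIso_transitive[OF assms(3) that(2)]] by blast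
  qed
qed

definition continuum :: "(nat \<Rightarrow> bool) rel" where
  "continuum = ctwo ^c natLeq"

definition complete_accumulation_point :: "'a topology \<Rightarrow> 'a set \<Rightarrow> 'a \<Rightarrow> bool" where
  "complete_accumulation_point X A p \<longleftrightarrow>
     p \<in> topspace X \<and> (\<forall>U. openin X U \<and> p \<in> U \<longrightarrow> |U \<inter> A| =o |A| )"

text \<open>
  \<^const>\<open>regularCard\<close> expresses regularity only for infinite cardinals; it is used for no others.
\<close>

definition linearly_Lindelof_space :: "'a topology \<Rightarrow> bool" where
  "linearly_Lindelof_space X \<longleftrightarrow>
     (\<forall>A. A \<subseteq> topspace X \<and> uncountable A \<and> regularCard |A|
       \<longrightarrow> (\<exists>p. complete_accumulation_point X A p))"

definition countably_tight_space :: "'a topology \<Rightarrow> bool" where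
  "countably_tight_space X \<longleftrightarrow>
     (\<forall>A x. A \<subseteq> topspace X \<and> x \<in> X closure_of A
       \<longrightarrow> (\<exists>B. B \<subseteq> A \<and> countable B \<and> x \<in> X closure_of B))"

definition Gdelta_modification :: "'a topology \<Rightarrow> 'a topology" where
  "Gdelta_modification X = topology_generated_by {G. gdelta_in X G}"

lemma topspace_Gdelta_modification [simp]: "topspace (Gdelta_modification X) = topspace X"
proof -
  have "gdelta_in X (topspace X)"
    by (simp add: open_imp_gdelta_in)
  then have "\<Union>{G. gdelta_in X G} = topspace X"
    using gdelta_in_subset by blast
  then show ?thesis
    unfolding Gdelta_modification_def topology_generated_by_topspace .
qed

text \<open>
  Both numbers below are at most \<open>|X| + \<omega>\<close>; the summand \<^typ>\<open>nat\<close> provides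
  infinite cardinals also when \<^typ>\<open>'a\<close> is finite.
\<close>

definition Lindelof_bound :: "'a topology \<Rightarrow> 'b rel \<Rightarrow> bool" where
  "Lindelof_bound Y \<mu> \<longleftrightarrow>
     (\<forall>\<U>. (\<forall>U\<in>\<U>. openin Y U) \<and> \<Union>\<U> = topspace Y
       \<longrightarrow> (\<exists>\<V>. \<V> \<subseteq> \<U> \<and> |\<V>| \<le>o \<mu> \<and> \<Union>\<V> = topspace Y))"

definition Lindelof_number :: "'a topology \<Rightarrow> ('a + nat) rel" where
  "Lindelof_number Y = card_Least (\<lambda>\<mu>. cinfinite \<mu> \<and> Lindelof_bound Y \<mu>)"

definition linear_Lindelof_bound :: "'a topology \<Rightarrow> 'b rel \<Rightarrow> bool" where
  "linear_Lindelof_bound Y \<mu> \<longleftrightarrow>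
     (\<forall>A. A \<subseteq> topspace Y \<and> \<mu> <o |A| \<and> regularCard |A|
       \<longrightarrow> (\<exists>p. complete_accumulation_point Y A p))"

definition linear_Lindelof_number :: "'a topology \<Rightarrow> ('a + nat) rel" where
  "linear_Lindelof_number Y = card_Least (\<lambda>\<mu>. cinfinite \<mu> \<and> linear_Lindelof_bound Y \<mu>)"

lemma Cinfinite_card_of_plus_nat: "Cinfinite |UNIV :: ('a + nat) set|"
  by (simp add: cinfinite_def Field_card_of card_of_card_order_on)

lemma card_of_ordLeq_plus_nat: "|A :: 'a set| \<le>o |UNIV :: ('a + nat) set|"
  by (rule card_of_ordLeqI[where f = Inl]) auto

lemma Lindelof_bound_exists: "Lindelof_bound Y |UNIV :: ('a + nat) set|"
  for Y :: "'a topology"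
  unfolding Lindelof_bound_def
proof (intro allI impI)
  fix \<U> assume \<U>: "(\<forall>U\<in>\<U>. openin Y U) \<and> \<Union>\<U> = topspace Y"
  then have "\<forall>x\<in>topspace Y. \<exists>U. U \<in> \<U> \<and> x \<in> U"
    by blast
  then obtain f where f: "\<forall>x\<in>topspace Y. f x \<in> \<U> \<and> x \<in> f x"
    unfolding bchoice_iff by blast
  have "|f ` topspace Y| \<le>o |UNIV :: ('a + nat) set|"
    by (rule ordLeq_transitive[OF card_of_image card_of_ordLeq_plus_nat])
  then show "\<exists>\<V>. \<V> \<subseteq> \<U> \<and> |\<V>| \<le>o |UNIV :: ('a + nat) set| \<and> \<Union>\<V> = topspace Y"
    using f \<U> by (intro exI[of _ "f ` topspace Y"] conjI) blast+
qed

lemma linear_Lindelof_bound_exists: "linear_Lindelof_bound Y |UNIV :: ('a + nat) set|"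
  for Y :: "'a topology"
  unfolding linear_Lindelof_bound_def
  using card_of_ordLeq_plus_nat not_ordLess_ordLeq by blast

lemma Lindelof_number_works:
  fixes Y :: "'a topology"
  shows "Cinfinite (Lindelof_number Y)" "Lindelof_bound Y (Lindelof_number Y)"
  using card_Least_works[of "|UNIV :: ('a + nat) set|" "\<lambda>\<mu>. cinfinite \<mu> \<and> Lindelof_bound Y \<mu>"]
    Cinfinite_card_of_plus_nat Lindelof_bound_exists[of Y] unfolding Lindelof_number_def by blast+

lemma linear_Lindelof_number_works:
  fixes Y :: "'a topology"
  shows "Cinfinite (linear_Lindelof_number Y)" "linear_Lindelof_bound Y (linear_Lindelof_number Y)"
  using card_Least_works[of "|UNIV :: ('a + nat) set|" "\<lambda>\<mu>. cinfinite \<mu> \<and> linear_Lindelof_bound Y \<mu>"]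
    Cinfinite_card_of_plus_nat linear_Lindelof_bound_exists[of Y]
  unfolding linear_Lindelof_number_def by blast+

lemma Lindelof_number_le:
  fixes Y :: "'a topology" and \<mu> :: "'b rel"
  assumes "Cinfinite \<mu>" "Lindelof_bound Y \<mu>"
  shows "Lindelof_number Y \<le>o \<mu>"
  unfolding Lindelof_number_def
proof (rule card_Least_le)
  show "Card_order |UNIV :: ('a + nat) set|" by (rule card_of_Card_order)
  show "cinfinite |UNIV :: ('a + nat) set| \<and> Lindelof_bound Y |UNIV :: ('a + nat) set|"
    using Cinfinite_card_of_plus_nat Lindelof_bound_exists by blast
  show "Card_order \<mu>" using assms by blast
  show "cinfinite p \<and> Lindelof_bound Y p" if "\<mu> =o p" for p :: "('a + nat) rel"
  proof
    show "cinfinite p"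
      using Cinfinite_cong[OF that assms(1)] by blast
    show "Lindelof_bound Y p"
      unfolding Lindelof_bound_def
    proof (intro allI impI)
      fix \<U> assume "(\<forall>U\<in>\<U>. openin Y U) \<and> \<Union>\<U> = topspace Y"
      from assms(2)[unfolded Lindelof_bound_def, rule_format, OF this]
      obtain \<V> where "\<V> \<subseteq> \<U>" "|\<V>| \<le>o \<mu>" "\<Union>\<V> = topspace Y"
        by (elim exE conjE)
      then show "\<exists>\<V>. \<V> \<subseteq> \<U> \<and> |\<V>| \<le>o p \<and> \<Union>\<V> = topspace Y"
        by (intro exI[of _ \<V>] conjI ordLeq_ordIso_trans[OF _ that])
    qed
  qed
qed

lemma linear_Lindelof_number_le:
  fixes Y :: "'a topology" and \<mu> :: "'b rel"
  assumes "Cinfinite \<mu>" "linear_Lindelof_bound Y \<mu>"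
  shows "linear_Lindelof_number Y \<le>o \<mu>"
  unfolding linear_Lindelof_number_def
proof (rule card_Least_le)
  show "Card_order |UNIV :: ('a + nat) set|" by (rule card_of_Card_order)
  show "cinfinite |UNIV :: ('a + nat) set| \<and> linear_Lindelof_bound Y |UNIV :: ('a + nat) set|"
    using Cinfinite_card_of_plus_nat linear_Lindelof_bound_exists by blast
  show "Card_order \<mu>" using assms by blast
  show "cinfinite p \<and> linear_Lindelof_bound Y p" if "\<mu> =o p" for p :: "('a + nat) rel"
  proof
    show "cinfinite p"
      using Cinfinite_cong[OF that assms(1)] by blast
    show "linear_Lindelof_bound Y p"
      unfolding linear_Lindelof_bound_def
    proof (intro allI impI, elim conjE)
      fix A assume A: "A \<subseteq> topspace Y" "p <o |A|" "regularCard |A|"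
      from that A(2) have "\<mu> <o |A|"
        by (rule ordIso_ordLess_trans)
      with A(1,3) show "\<exists>q. complete_accumulation_point Y A q"
        using assms(2) unfolding linear_Lindelof_bound_def by blast
    qed
  qed
qed

end

theory Submission
  imports Defs
begin

text \<open>
  Since \<open>\<cc>\<close> has uncountable cofinality, a family of at most \<open>\<cc>\<close> open sets covering a
  closed subspace of \<open>X\<close> has a subcover of size \<open>< \<cc>\<close>. By regularity, closures of
  countable sets have weight at most \<open>\<cc>\<close>, hence are covered by \<open>\<cc>\<close> members of any
  cover by \<open>G\<close>-delta sets. Given such a cover, with each member an intersection of open sets
  \<open>V z n\<close>, and \<open>\<rho> ^ \<nu> \<le> \<rho>\<close> for all \<open>\<nu> < \<cc>\<close>, close off under operations on sets of
  size \<open>< \<cc>\<close> to get \<open>H\<close> of size \<open>\<le> \<rho>\<close> such that the members indexed by \<open>H\<close> cover the closure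
  of every countable subset of \<open>H\<close>, and \<open>H\<close> is covered by \<open>< \<cc>\<close> of the sets \<open>V z n\<close> with
  \<open>z \<in> H\<close> only if \<open>X\<close> is. If the members indexed by \<open>H\<close> missed a point \<open>x\<close>,
  pick for each \<open>z \<in> H\<close> some \<open>V z n\<close> avoiding \<open>x\<close>. Fewer than \<open>\<cc>\<close> of these cover the closure
  of any given countable subset of \<open>H\<close>, but fewer than \<open>\<cc>\<close> never cover \<open>H\<close>. This yields a free
  sequence of length \<open>\<omega>\<^sub>1\<close> in \<open>H\<close>, which linear Lindeloefness and countable tightness
  exclude.
\<close>

section \<open>Cofinality and cardinal bounds\<close>

text \<open>Koenig's theorem in the form: the exponent bound forces the cofinality of
  \<open>r\<close> above \<open>|S|\<close>. If \<open>S\<close> were cofinal, the enumeration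
  \<open>F\<close> of all functions from \<open>S\<close> to \<open>Field r\<close> could be
  diagonalized: \<open>g s\<close> avoids the fewer than \<open>r\<close> values
  \<open>F i s\<close> with \<open>i\<close> up to \<open>s\<close>, and every \<open>i\<close> lies
  below some \<open>s\<close>.\<close>

lemma koenig_bounded:
  fixes r :: "'r rel"
  assumes r: "Cinfinite r" and S: "S \<subseteq> Field r" and pow: "r ^c |S| \<le>o r"
  shows "\<exists>i\<in>Field r. S \<subseteq> underS r i"
proof (rule ccontr)
  assume unbounded: "\<not> (\<exists>i\<in>Field r. S \<subseteq> underS r i)"
  have wo: "wo_rel r"
    using r by (simp add: card_order_on_well_order_on wo_rel_def)
  have cofinal: "\<exists>s\<in>S. (i, s) \<in> r" if "i \<in> Field r" for i
    using unbounded that S wo_rel.TOTALS[OF wo] wo_rel.REFL[OF wo]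
    unfolding underS_def refl_on_def by blast
  have field: "|Field r| =o r"
    using r card_of_Field_ordIso by blast
  have ne: "Field r \<noteq> {}"
    using r by (auto simp: cinfinite_def)
  then have "Func S (Field r) \<noteq> {}"
    by (simp add: Func_is_emp)
  moreover have "|Func S (Field r)| \<le>o |Field r|"
    using pow ordLeq_ordIso_trans[OF _ ordIso_symmetric[OF field]]
    by (simp add: cexp_def Field_card_of)
  ultimately obtain F where F: "F ` Field r = Func S (Field r)"
    using card_of_ordLeq2 by metis
  have "\<exists>y\<in>Field r. y \<notin> (\<lambda>i. F i s) ` under r s" if "s \<in> S" for s
  proof -
    have s: "s \<in> Field r" using that S by blast
    have under: "under r s = insert s (underS r s)"
      using s wo_rel.REFL[OF wo] by (auto simp: under_def underS_def refl_on_def)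
    have "|underS r s| <o r"
      using r s by (intro card_of_underS) simp_all
    moreover have "|{s}| <o r"
      using r Cfinite_ordLess_Cinfinite[of "|{s}|" r]
      by (simp add: cfinite_def Field_card_of card_of_card_order_on)
    ultimately have "|under r s| <o r"
      unfolding under using r Un_Cinfinite_bound_strict[of "{s}" r "underS r s"] by simp
    then have "|(\<lambda>i. F i s) ` under r s| <o |Field r|"
      by (intro ordLeq_ordLess_trans[OF card_of_image]
          ordLess_ordIso_trans[OF _ ordIso_symmetric[OF field]])
    then show ?thesis
      using card_of_mono1[of "Field r" "(\<lambda>i. F i s) ` under r s"] not_ordLess_ordLeq
      by blast
  qed
  then obtain g where g: "\<And>s. s \<in> S \<Longrightarrow> g s \<in> Field r \<and> g s \<notin> (\<lambda>i. F i s) ` under r s"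
    by metis
  then have "(\<lambda>s. if s \<in> S then g s else undefined) \<in> Func S (Field r)"
    by (auto simp: Func_def)
  then obtain i where i: "i \<in> Field r" "F i = (\<lambda>s. if s \<in> S then g s else undefined)"
    using F by (metis (no_types, lifting) imageE)
  obtain s where "s \<in> S" "(i, s) \<in> r"
    using cofinal i by blast
  then have "g s \<in> (\<lambda>i. F i s) ` under r s"
    using i by (auto simp: under_def intro!: image_eqI[of _ _ i])
  then show False
    using g \<open>s \<in> S\<close> by blast
qed

lemma countable_iff_ordLeq_natLeq: "countable A \<longleftrightarrow> |A| \<le>o natLeq"
proof -
  have "countable A \<longleftrightarrow> |A| \<le>o |UNIV :: nat set|"
    unfolding countable_def using card_of_ordLeq[of A "UNIV :: nat set"] by auto
  also have "\<dots> \<longleftrightarrow> |A| \<le>o natLeq"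
    using card_of_nat ordLeq_ordIso_trans ordIso_symmetric by blast
  finally show ?thesis .
qed

lemma cexp_countable_ordLeq:
  fixes r :: "'r rel"
  assumes r: "Cinfinite r" "r ^c natLeq \<le>o r" and A: "countable A"
  shows "r ^c |A| \<le>o r"
proof -
  have "r ^c |A| \<le>o r ^c natLeq"
  proof (cases "A = {}")
    case True
    have "Func {} (Field r) = {\<lambda>x. undefined}"
      by (rule Func_empty)
    moreover have "Func (UNIV :: nat set) (Field r) \<noteq> {}"
      using r by (auto simp: Func_is_emp cinfinite_def)
    ultimately show ?thesis
      unfolding cexp_def Field_natLeq True Field_card_of
      by (metis card_of_singl_ordLeq)
  next
    case False
    then show ?thesis
      using A r cexp_mono2' natLeq_Card_order unfolding countable_iff_ordLeq_natLeq
      by (metis Field_card_of card_of_Card_order)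
  qed
  then show ?thesis
    using r ordLeq_transitive by blast
qed

lemma countable_bounded:
  fixes r :: "'r rel"
  assumes "Cinfinite r" "r ^c natLeq \<le>o r" "countable S" "S \<subseteq> Field r"
  shows "\<exists>i\<in>Field r. S \<subseteq> underS r i"
  using assms by (intro koenig_bounded cexp_countable_ordLeq)

text \<open>Replaces a cardinality below \<open>r\<close> by an index in \<open>Field r\<close>, so
  that bounding a set of indices bounds all the cardinalities uniformly.\<close>

lemma ordLess_imp_ordLeq_underS:
  assumes "Card_order r" "|A| <o r"
  shows "\<exists>i\<in>Field r. |A| \<le>o |underS r i|"
proof -
  obtain i where i: "i \<in> Field r" "|A| =o Restr r (underS r i)"
    using assms ordLess_iff_ordIso_Restr[of r "|A|"] card_of_Well_order
      card_order_on_well_order_on by blast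
  have "Well_order (Restr r (underS r i))"
    using assms by (simp add: Well_order_Restr card_order_on_well_order_on)
  then have "|Field |A|| =o |Field (Restr r (underS r i))|"
    using card_of_cong i by blast
  moreover have "Field (Restr r (underS r i)) \<subseteq> underS r i"
    by (auto simp: Field_def)
  ultimately have "|A| \<le>o |underS r i|"
    by (metis Field_card_of card_of_mono1 ordIso_ordLeq_trans)
  then show ?thesis using i by blast
qed

text \<open>The cofinality of \<open>r\<close> is uncountable, so one initial segment bounds the
  sizes of all the \<open>A i\<close>. Regularity of \<open>r\<close> is not assumed, since the
  continuum may be singular.\<close>

lemma countable_UN_ordLess:
  fixes r :: "'r rel"
  assumes r: "Cinfinite r" "r ^c natLeq \<le>o r" and I: "countable I"
    and less: "\<And>i. i \<in> I \<Longrightarrow> |A i| <o r"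
  shows "|\<Union>i\<in>I. A i| <o r"
proof -
  have "\<forall>i\<in>I. \<exists>k\<in>Field r. |A i| \<le>o |underS r k|"
    using ordLess_imp_ordLeq_underS less r by blast
  then obtain k where k: "\<And>i. i \<in> I \<Longrightarrow> k i \<in> Field r \<and> |A i| \<le>o |underS r (k i)|"
    by metis
  have "countable (k ` I)" "k ` I \<subseteq> Field r"
    using I k by auto
  then obtain m where m: "m \<in> Field r" "k ` I \<subseteq> underS r m"
    using countable_bounded r by blast
  have trans: "trans r"
    using r by (simp add: card_order_on_well_order_on wo_rel_def wo_rel.TRANS)
  have antisym: "antisym r"
    using r by (simp add: card_order_on_well_order_on wo_rel_def wo_rel.ANTISYM)
  have nat_less: "natLeq <o r"
  proof -
    have "natLeq <o ctwo ^c natLeq"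
      using ordLess_ctwo_cexp natLeq_Card_order by blast
    also have "ctwo ^c natLeq \<le>o r ^c natLeq"
      using cexp_mono1 natLeq_Card_order ctwo_ordLeq_Cinfinite r by blast
    also have "r ^c natLeq \<le>o r" by fact
    finally show ?thesis .
  qed
  \<comment> \<open>The summand \<open>nat\<close> makes the bound infinite and at least
    \<open>|I|\<close>, as the union bound requires.\<close>
  let ?B = "underS r m <+> (UNIV :: nat set)"
  have "|UNIV :: nat set| <o r"
    using card_of_nat nat_less ordIso_ordLess_trans by blast
  then have B: "|?B| <o r"
    using r card_of_underS[of r m] m(1)
    by (intro card_of_Plus_ordLess_infinite_Field) (simp_all add: cinfinite_def)
  have "|A i| \<le>o |?B|" if "i \<in> I" for i
  proof -
    have "underS r (k i) \<subseteq> underS r m"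
      using m(2) that trans antisym unfolding underS_def trans_def antisym_def by blast
    then show ?thesis
      using k[OF that] card_of_mono1 card_of_Plus1 ordLeq_transitive by metis
  qed
  moreover have "|I| \<le>o |?B|"
    using I card_of_Plus2 ordLeq_transitive countable_iff_ordLeq_natLeq card_of_nat
      ordLeq_ordIso_trans ordIso_symmetric by metis
  ultimately have "|\<Union>i\<in>I. A i| \<le>o |?B|"
    by (intro card_of_UNION_ordLeq_infinite) auto
  then show ?thesis
    using B ordLeq_ordLess_trans by blast
qed

section \<open>Subcovers in linearly Lindeloef spaces\<close>

text \<open>A counterexample \<open>A0\<close> of least size is thinned out to \<open>A\<close>,
  which meets each member of the chain in fewer than \<open>|A|\<close> points. Minimality makes
  \<open>A\<close> uncountable of regular cardinality, so it has a complete accumulation point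
  \<open>p\<close> in \<open>C\<close>. The countable set \<open>{p}\<close> lies in some member of
  the chain, a contradiction.\<close>

lemma linearly_Lindelof_chain:
  assumes X: "linearly_Lindelof_space X" and C: "closedin X C"
    and op: "\<And>W. W \<in> \<W> \<Longrightarrow> openin X W"
    and chain: "\<And>V W. V \<in> \<W> \<Longrightarrow> W \<in> \<W> \<Longrightarrow> V \<subseteq> W \<or> W \<subseteq> V"
    and small: "\<And>B. B \<subseteq> C \<Longrightarrow> countable B \<Longrightarrow> \<exists>W\<in>\<W>. B \<subseteq> W"
  shows "\<exists>W\<in>\<W>. C \<subseteq> W"
proof (rule ccontr)
  assume neg: "\<not> (\<exists>W\<in>\<W>. C \<subseteq> W)"
  let ?R = "{ |B| | B. B \<subseteq> C \<and> \<not> (\<exists>W\<in>\<W>. B \<subseteq> W)}"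
  have "\<exists>r\<in>?R. \<forall>r'\<in>?R. r \<le>o r'"
    by (rule exists_minim_Card_order) (use neg card_of_Card_order in auto)
  then obtain r A0 where "r = |A0|" and A0: "A0 \<subseteq> C" "\<not> (\<exists>W\<in>\<W>. A0 \<subseteq> W)"
    and "\<forall>r'\<in>?R. r \<le>o r'"
    by blast
  then have min: "|A0| \<le>o |B|" if "B \<subseteq> C" "\<not> (\<exists>W\<in>\<W>. B \<subseteq> W)" for B
    using that by blast
  have less: "\<exists>W\<in>\<W>. B \<subseteq> W" if "B \<subseteq> C" "|B| <o |A0|" for B
    using min[OF that(1)] that(2) not_ordLess_ordLeq by blast
  define m where "m = |A0|"
  have m: "wo_rel m" "Field m = A0" "Card_order m"
    by (simp_all add: m_def wo_rel_def card_of_well_order_on Field_card_of card_of_card_order_on)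
  \<comment> \<open>Keep only the points entering the chain later than all their predecessors: the order \<open>m\<close>
    then agrees with the time of entry, so each \<open>W\<close> contains fewer than \<open>|A|\<close> points of \<open>A\<close>.\<close>
  define A where "A = {a \<in> A0. \<exists>W\<in>\<W>. a \<notin> W \<and> underS m a \<subseteq> W}"
  have A_sub: "A \<subseteq> A0"
    by (auto simp: A_def)
  have cofinal: "\<exists>a\<in>A. a \<notin> W" if W: "W \<in> \<W>" for W
  proof -
    \<comment> \<open>The first point of \<open>A0\<close> outside \<open>W\<close> belongs to
      \<open>A\<close>, with \<open>W\<close> itself as witness.\<close>
    have "wf (m - Id)"
      using m(1) wo_rel.WF by blast
    moreover have "A0 - W \<noteq> {}"
      using A0(2) W by blast
    ultimately obtain a where a: "a \<in> A0 - W" and "\<And>b. (b, a) \<in> m - Id \<Longrightarrow> b \<notin> A0 - W"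
      by (rule wfE_min') blast
    then have "underS m a \<subseteq> W"
      using m(2) unfolding underS_def Field_def by blast
    then show ?thesis
      using a W unfolding A_def by blast
  qed
  then have "|A0| \<le>o |A|"
    using A_sub A0(1) by (intro min) blast+
  then have iso: "|A| =o |A0|"
    using A_sub card_of_mono1 by (simp add: ordIso_iff_ordLeq)
  have seg: "|A \<inter> W| <o |A|" if W: "W \<in> \<W>" for W
  proof -
    obtain b where b: "b \<in> A" "b \<notin> W"
      using cofinal W by blast
    have "A \<inter> W \<subseteq> underS m b"
    proof
      fix a assume a: "a \<in> A \<inter> W"
      then obtain V where V: "V \<in> \<W>" "a \<notin> V" "underS m a \<subseteq> V"
        unfolding A_def by blast
      then have "V \<subseteq> W"
        using chain[OF W, of V] a by blast
      then have "b \<notin> underS m a"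
        using V b by blast
      moreover have "b \<noteq> a"
        using a b by blast
      ultimately show "a \<in> underS m b"
        using wo_rel.TOTALS[OF m(1)] a b(1) A_sub m(2) unfolding underS_def by blast
    qed
    moreover have "|underS m b| <o m"
      using card_of_underS[OF m(3), of b] b(1) A_sub m(2) by blast
    ultimately have "|A \<inter> W| <o |A0|"
      unfolding m_def using card_of_mono1 ordLeq_ordLess_trans by blast
    then show ?thesis
      using ordLess_ordIso_trans ordIso_symmetric[OF iso] by blast
  qed
  have less_A: "\<exists>W\<in>\<W>. B \<subseteq> W" if "B \<subseteq> C" "|B| <o |A|" for B
    using less[OF that(1)] ordLess_ordIso_trans[OF that(2) iso] by blast
  have AC: "A \<subseteq> C" using A_sub A0 by blast
  have unc: "uncountable A"
    using small[OF AC] cofinal by blast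
  \<comment> \<open>If a cofinal \<open>K\<close> were smaller than \<open>A\<close>, pick
    \<open>V k\<close> containing the segment below \<open>k\<close> and \<open>q k\<close> outside
    \<open>V k\<close>. By minimality some \<open>W\<close> contains all the \<open>q k\<close>, so
    as a member of the chain it contains every \<open>V k\<close> and hence
    \<open>A\<close>.\<close>
  have reg: "regularCard |A|"
    unfolding regularCard_def Field_card_of
  proof (intro allI impI, elim conjE)
    fix K assume K: "K \<subseteq> A" "cofinal K |A|"
    have "|K| \<le>o |A|" by (rule card_of_mono1) fact
    moreover have "\<not> |K| <o |A|"
    proof
      assume less_K: "|K| <o |A|"
      have "\<exists>W\<in>\<W>. underS |A| k \<subseteq> W" if "k \<in> K" for k
      proof (rule less_A)
        have k: "k \<in> Field |A|" using that K by (auto simp: Field_card_of)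
        show "underS |A| k \<subseteq> C"
          using AC unfolding underS_def by (metis (no_types, lifting) Field_card_of FieldI1 mem_Collect_eq subsetD subsetI)
        show "|underS |A| k| <o |A|"
          by (rule card_of_underS[OF card_of_Card_order k])
      qed
      then obtain V where V: "\<And>k. k \<in> K \<Longrightarrow> V k \<in> \<W> \<and> underS |A| k \<subseteq> V k"
        by metis
      then have "\<exists>q\<in>A. q \<notin> V k" if "k \<in> K" for k
        using cofinal that by blast
      then obtain q where q: "\<And>k. k \<in> K \<Longrightarrow> q k \<in> A \<and> q k \<notin> V k"
        by metis
      have "\<exists>W\<in>\<W>. q ` K \<subseteq> W"
        using q AC by (intro less_A ordLeq_ordLess_trans[OF card_of_image less_K]) blast
      then obtain W where W: "W \<in> \<W>" "q ` K \<subseteq> W" by blast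
      have "V k \<subseteq> W" if "k \<in> K" for k
        using chain[of "V k" W] V[OF that] q[OF that] W that by blast
      then have "A \<subseteq> W"
        using K(2) V unfolding cofinal_def underS_def Field_card_of by blast
      then show False
        using cofinal[OF W(1)] by blast
    qed
    ultimately show "|K| =o |A|"
      using ordLeq_iff_ordLess_or_ordIso by blast
  qed
  have "A \<subseteq> topspace X"
    using AC C closedin_subset by blast
  then have "\<exists>p. complete_accumulation_point X A p"
    using X[unfolded linearly_Lindelof_space_def, rule_format, of A] unc reg by simp
  then obtain p where p: "complete_accumulation_point X A p" ..
  have "p \<in> C"
  proof (rule ccontr)
    assume "p \<notin> C"
    then have "p \<in> topspace X - C" "openin X (topspace X - C)"
      using p C by (auto simp: complete_accumulation_point_def)
    then have "|(topspace X - C) \<inter> A| =o |A|"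
      using p unfolding complete_accumulation_point_def by blast
    moreover have "(topspace X - C) \<inter> A = {}"
      using AC by blast
    ultimately have "A = {}"
      by (metis card_of_empty_ordIso ordIso_symmetric card_of_empty2)
    then show False using unc by simp
  qed
  then obtain W where W: "W \<in> \<W>" "p \<in> W"
    using small[of "{p}"] by auto
  then have "|W \<inter> A| =o |A|"
    using p op unfolding complete_accumulation_point_def by blast
  then show False
    using seg[OF W(1)] not_ordLess_ordIso by (metis Int_commute)
qed

text \<open>Indices are placed in \<open>Field r\<close>; the unions over proper initial segments
  form a chain. A countable subset of \<open>C\<close> uses countably many indices, which are
  bounded in \<open>r\<close>, so the chain lemma yields one segment that suffices.\<close>

lemma linearly_Lindelof_ordLess_subcover:
  fixes r :: "'r rel"
  assumes X: "linearly_Lindelof_space X" and C: "closedin X C"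
    and r: "Cinfinite r" "r ^c natLeq \<le>o r"
    and I: "|I| \<le>o r" and op: "\<And>i. i \<in> I \<Longrightarrow> openin X (Q i)" and cover: "C \<subseteq> (\<Union>i\<in>I. Q i)"
  shows "\<exists>J\<subseteq>I. |J| <o r \<and> C \<subseteq> (\<Union>i\<in>J. Q i)"
proof -
  have "|I| \<le>o |Field r|"
    using I r(1) card_of_Field_ordIso ordIso_symmetric ordLeq_ordIso_trans by metis
  then obtain f where f: "inj_on f I" "f ` I \<subseteq> Field r"
    using card_of_ordLeq by metis
  define J where "J k = {i \<in> I. f i \<in> underS r k}" for k
  have trans: "trans r" and antisym: "antisym r" and total: "Total r"
    using r by (simp_all add: card_order_on_well_order_on wo_rel_def wo_rel.ANTISYM wo_rel.TRANS
        wo_rel.TOTAL)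
  have J_mono: "J k \<subseteq> J l" if "(k, l) \<in> r" for k l
    using that trans antisym unfolding J_def underS_def trans_def antisym_def by blast
  have J_total: "J k \<subseteq> J l \<or> J l \<subseteq> J k" if "k \<in> Field r" "l \<in> Field r" for k l
    using J_mono[of k l] J_mono[of l k] that total unfolding total_on_def by (cases "k = l") auto
  have "\<exists>W\<in>(\<lambda>k. \<Union>i\<in>J k. Q i) ` Field r. C \<subseteq> W"
  proof (rule linearly_Lindelof_chain[OF X C])
    show "openin X W" if "W \<in> (\<lambda>k. \<Union>i\<in>J k. Q i) ` Field r" for W
      using that op unfolding J_def by auto
    show "V \<subseteq> W \<or> W \<subseteq> V" if "V \<in> (\<lambda>k. \<Union>i\<in>J k. Q i) ` Field r" "W \<in> (\<lambda>k. \<Union>i\<in>J k. Q i) ` Field r" for V W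
      using that J_total by blast
    show "\<exists>W\<in>(\<lambda>k. \<Union>i\<in>J k. Q i) ` Field r. B \<subseteq> W" if B: "B \<subseteq> C" "countable B" for B
    proof -
      have "\<forall>b\<in>B. \<exists>i\<in>I. b \<in> Q i"
        using B cover by blast
      then obtain i where i: "\<And>b. b \<in> B \<Longrightarrow> i b \<in> I \<and> b \<in> Q (i b)"
        by metis
      have "countable ((\<lambda>b. f (i b)) ` B)" "(\<lambda>b. f (i b)) ` B \<subseteq> Field r"
        using B i f by auto
      then obtain k where k: "k \<in> Field r" "(\<lambda>b. f (i b)) ` B \<subseteq> underS r k"
        using countable_bounded[OF r] by blast
      then have "B \<subseteq> (\<Union>i\<in>J k. Q i)"
        using i unfolding J_def by blast
      then show ?thesis using k by blast
    qed
  qed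
  then obtain k where k: "k \<in> Field r" "C \<subseteq> (\<Union>i\<in>J k. Q i)"
    by blast
  have "|J k| \<le>o |underS r k|"
    using f by (intro card_of_ordLeqI[of f]) (auto simp: J_def inj_on_def)
  also have "|underS r k| <o r"
    using r k by (intro card_of_underS) simp_all
  finally have "|J k| <o r" .
  moreover have "J k \<subseteq> I"
    by (auto simp: J_def)
  ultimately show ?thesis
    using k by blast
qed

section \<open>Closures of countable sets in regular spaces\<close>

text \<open>By regularity, each \<open>G i\<close> containing a point \<open>y\<close> of the
  closure also contains an intersection, over \<open>n\<close>, of closures of sets
  \<open>V n \<inter> A\<close> that still contains \<open>y\<close>. Only continuum many sequences
  of subsets of the countable set \<open>A\<close> exist, and one index per sequence is
  enough.\<close>

lemma Gdelta_subcover_closure_of_countable: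
  fixes X :: "'a topology" and G :: "'i \<Rightarrow> 'a set"
  assumes X: "regular_space X" and A: "countable A" "A \<subseteq> topspace X"
    and G: "\<And>i. i \<in> I \<Longrightarrow> gdelta_in X (G i)" and cover: "X closure_of A \<subseteq> (\<Union>i\<in>I. G i)"
  shows "\<exists>J\<subseteq>I. |J| \<le>o continuum \<and> X closure_of A \<subseteq> (\<Union>i\<in>J. G i)"
proof -
  define S where "S = {B :: nat \<Rightarrow> 'a set. (\<forall>n. B n \<subseteq> A) \<and> (\<exists>i\<in>I. (\<Inter>n. X closure_of B n) \<subseteq> G i)}"
  have "\<forall>B\<in>S. \<exists>i. i \<in> I \<and> (\<Inter>n. X closure_of B n) \<subseteq> G i"
    by (auto simp: S_def)
  then obtain c where "\<forall>B\<in>S. c B \<in> I \<and> (\<Inter>n. X closure_of B n) \<subseteq> G (c B)"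
    unfolding bchoice_iff ..
  then have c: "c B \<in> I \<and> (\<Inter>n. X closure_of B n) \<subseteq> G (c B)" if "B \<in> S" for B
    using that by (rule bspec)
  have "X closure_of A \<subseteq> (\<Union>i\<in>c ` S. G i)"
  proof
    fix y assume y: "y \<in> X closure_of A"
    then obtain i where i: "i \<in> I" "y \<in> G i"
      using cover by blast
    then obtain U :: "nat \<Rightarrow> 'a set" where U: "\<And>n. openin X (U n)" "(\<Inter>n. U n) = G i"
      using G[OF i(1)] unfolding gdelta_in_descending by metis
    have "\<exists>V. openin X V \<and> y \<in> V \<and> X closure_of V \<subseteq> U n" for n
    proof -
      have "y \<in> U n" using i U by blast
      then have "closedin X (topspace X - U n)" "y \<in> topspace X - (topspace X - U n)"
        using U(1)[of n] openin_subset by blast+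
      then obtain V where V: "openin X V" "y \<in> V" "disjnt (topspace X - U n) (X closure_of V)"
        using X unfolding regular_space by meson
      then have "X closure_of V \<subseteq> U n"
        using closure_of_subset_topspace[of X V] unfolding disjnt_def by blast
      then show ?thesis
        using V by blast
    qed
    then obtain V where V: "\<And>n. openin X (V n) \<and> y \<in> V n \<and> X closure_of V n \<subseteq> U n"
      by metis
    have y_in: "y \<in> X closure_of (V n \<inter> A)" for n
      using openin_Int_closure_of_subset[of X "V n" A] V[of n] y by blast
    have "X closure_of (V n \<inter> A) \<subseteq> U n" for n
      using V[of n] closure_of_mono[of "V n \<inter> A" "V n" X] by blast
    then have "(\<Inter>n. X closure_of (V n \<inter> A)) \<subseteq> G i"
      unfolding U(2)[symmetric] by blast
    then have B: "(\<lambda>n. V n \<inter> A) \<in> S"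
      using i by (auto simp: S_def)
    \<comment> \<open>The index chosen by \<open>c\<close> may differ from \<open>i\<close>, but its
      set includes the whole intersection of closures and therefore \<open>y\<close>.\<close>
    have "y \<in> G (c (\<lambda>n. V n \<inter> A))"
      using c[OF B, THEN conjunct2] y_in by blast
    then show "y \<in> (\<Union>i\<in>c ` S. G i)"
      using B by blast
  qed
  moreover have "|c ` S| \<le>o continuum"
  proof -
    obtain f :: "'a \<Rightarrow> nat" where f: "inj_on f A"
      using A by (auto simp: countable_def)
    have "|S| \<le>o |UNIV :: (nat \<Rightarrow> bool) set|"
    proof (rule card_of_ordLeqI)
      \<comment> \<open>Codes a sequence of subsets of \<open>A\<close> as one set of naturals,
        those pairing \<open>n\<close> with \<open>f a\<close> for \<open>a\<close> in the
        \<open>n\<close>-th subset.\<close>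
      let ?h = "\<lambda>B k. \<exists>a. a \<in> B (fst (prod_decode k)) \<and> f a = snd (prod_decode k)"
      show "inj_on ?h S"
      proof (rule inj_onI)
        fix B C assume B: "B \<in> S" and C: "C \<in> S" and eq: "?h B = ?h C"
        have sub: "B n \<subseteq> A" "C n \<subseteq> A" for n
          using B C by (auto simp: S_def)
        have "a \<in> B n \<longleftrightarrow> a \<in> C n" for a n
        proof (cases "a \<in> A")
          case True
          have "a \<in> D n \<longleftrightarrow> ?h D (prod_encode (n, f a))" if "\<And>n. D n \<subseteq> A" for D
            using that[of n] True f unfolding inj_on_def by auto
          then show ?thesis using sub fun_cong[OF eq, of "prod_encode (n, f a)"] by simp
        next
          case False
          then show ?thesis using sub by blast
        qed
        then show "B = C" by blast
      qed
    qed auto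
    also have "|UNIV :: (nat \<Rightarrow> bool) set| =o continuum"
      unfolding continuum_def cexp_def ctwo_def Field_natLeq Field_card_of
      by (simp add: Func_def card_of_refl)
    finally show ?thesis
      using card_of_image ordLeq_transitive by blast
  qed
  ultimately show ?thesis
    using c by (intro exI[of _ "c ` S"]) blast
qed

section \<open>Free sequences\<close>

text \<open>Otherwise recursion gives points \<open>x i\<close> of \<open>H\<close>, for
  \<open>i\<close> below the first uncountable cardinal, each outside the neighbourhoods assigned to
  the initial segments up to \<open>i\<close>. Their set \<open>S\<close> has a complete
  accumulation point \<open>p\<close>, which countable tightness puts in the closure of an initial
  segment. The neighbourhood of that closure meets \<open>S\<close> only in the segment, which is
  countable.\<close>

lemma countable_cover_by_closure_neighbourhoods:
  fixes X :: "'a topology"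
  assumes X: "linearly_Lindelof_space X" "countably_tight_space X" and H: "H \<subseteq> topspace X"
    and O: "\<And>A. A \<subseteq> H \<Longrightarrow> countable A \<Longrightarrow> openin X (Q A) \<and> X closure_of A \<subseteq> Q A"
  shows "\<exists>\<A>. countable \<A> \<and> (\<forall>A\<in>\<A>. A \<subseteq> H \<and> countable A) \<and> H \<subseteq> (\<Union>A\<in>\<A>. Q A)"
proof (rule ccontr)
  assume neg: "\<not> ?thesis"
  define m where "m = cardSuc natLeq"
  have m: "Cinfinite m" "regularCard m"
    unfolding m_def by (simp_all add: Cinfinite_cardSuc natLeq_Cinfinite regularCard_cardSuc)
  have wo: "wo_rel m"
    using m by (simp add: card_order_on_well_order_on wo_rel_def)
  have below: "countable B \<longleftrightarrow> |B| <o m" for B :: "'b set"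
    unfolding countable_iff_ordLeq_natLeq m_def
    by (simp add: cardSuc_ordLeq_ordLess natLeq_Card_order card_of_Card_order)
  have underS: "countable (underS m i)" if "i \<in> Field m" for i
    unfolding below using m that by (intro card_of_underS) simp_all
  have under_eq: "under m i = insert i (underS m i)" if "i \<in> Field m" for i
    using that wo_rel.REFL[OF wo] by (auto simp: under_def underS_def refl_on_def)
  \<comment> \<open>Using \<open>under m i\<close> rather than \<open>underS m i\<close> makes
    \<open>x i\<close> avoid also the neighbourhood of its own initial segment; the case
    \<open>i = k\<close> of \<open>sep\<close> depends on this.\<close>
  define F where "F x i = (SOME z. z \<in> H \<and> z \<notin> (\<Union>j\<in>under m i. Q (x ` underS m j)))"
    for x :: "nat set \<Rightarrow> 'a" and i
  define x where "x = wfrec (m - Id) F"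
  have "wf (m - Id)"
    using wo wo_rel.WF by blast
  \<comment> \<open>For \<open>j\<close> up to \<open>i\<close>, only values of \<open>x\<close>
    strictly before \<open>i\<close> enter, so the cut in the recursion changes nothing.\<close>
  have x_eq: "x i = F x i" for i
  proof -
    have "x i = F (cut x (m - Id) i) i"
      unfolding x_def by (rule wfrec) fact
    moreover have "cut x (m - Id) i ` underS m j = x ` underS m j" if "j \<in> under m i" for j
    proof -
      have "(k, i) \<in> m - Id" if "k \<in> underS m j" for k
        using that \<open>j \<in> under m i\<close> wo_rel.TRANS[OF wo] wo_rel.ANTISYM[OF wo]
        unfolding underS_def under_def trans_def antisym_def by blast
      then show ?thesis
        by (simp add: cut_apply)
    qed
    ultimately show ?thesis
      unfolding F_def by simp
  qed
  have x: "x i \<in> H \<and> x i \<notin> (\<Union>j\<in>under m i. Q (x ` underS m j))" if "i \<in> Field m" for i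
    using that
  proof (induction i rule: wf_induct[OF \<open>wf (m - Id)\<close>])
    case (1 i)
    have sub: "x ` underS m j \<subseteq> H \<and> countable (x ` underS m j)" if "j \<in> under m i" for j
    proof -
      have "(k, i) \<in> m - Id" if "k \<in> underS m j" for k
        using that \<open>j \<in> under m i\<close> wo_rel.TRANS[OF wo] wo_rel.ANTISYM[OF wo]
        unfolding underS_def under_def trans_def antisym_def by blast
      moreover have "k \<in> Field m" if "k \<in> underS m j" for k
        using that unfolding underS_def Field_def by blast
      ultimately have "x k \<in> H" if "k \<in> underS m j" for k
        using 1(1) that by simp
      moreover have "j \<in> Field m"
        using that unfolding under_def Field_def by blast
      ultimately show ?thesis
        using underS by auto
    qed
    have "countable (under m i)"
      using under_eq underS 1 by simp
    then have "countable ((\<lambda>j. x ` underS m j) ` under m i)"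
      by (rule countable_image)
    moreover have "\<forall>A\<in>(\<lambda>j. x ` underS m j) ` under m i. A \<subseteq> H \<and> countable A"
      using sub by simp
    ultimately have "\<not> H \<subseteq> (\<Union>A\<in>(\<lambda>j. x ` underS m j) ` under m i. Q A)"
      using neg by blast
    then have "\<exists>z. z \<in> H \<and> z \<notin> (\<Union>j\<in>under m i. Q (x ` underS m j))"
      by auto
    then have "F x i \<in> H \<and> F x i \<notin> (\<Union>j\<in>under m i. Q (x ` underS m j))"
      unfolding F_def by (rule someI_ex)
    then show ?case
      unfolding x_eq[of i, symmetric] .
  qed
  have initial: "x ` underS m i \<subseteq> H \<and> countable (x ` underS m i)" if "i \<in> Field m" for i
  proof -
    have "k \<in> Field m" if "k \<in> underS m i" for k
      using that unfolding underS_def Field_def by blast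
    then show ?thesis
      using x underS[OF that] by auto
  qed
  have sep: "x k \<notin> Q (x ` underS m i)" if "(i, k) \<in> m" for i k
    using x[OF FieldI2[OF that]] that unfolding under_def by blast
  have capture: "x k \<in> Q (x ` underS m i)" if "(k, i) \<in> m" "k \<noteq> i" for i k
  proof -
    have i: "i \<in> Field m" and k: "k \<in> underS m i"
      using that unfolding underS_def Field_def by blast+
    then have "x ` underS m i \<subseteq> X closure_of (x ` underS m i)"
      using initial[OF i] H by (intro closure_of_subset) blast
    then show ?thesis
      using O[of "x ` underS m i"] initial[OF i] k by blast
  qed
  have inj: "inj_on x (Field m)"
  proof (rule inj_onI, rule ccontr)
    fix i j assume ij: "i \<in> Field m" "j \<in> Field m" "x i = x j" "i \<noteq> j"
    then have "(i, j) \<in> m \<or> (j, i) \<in> m"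
      using wo_rel.TOTALS[OF wo] by blast
    then show False
    proof
      assume "(i, j) \<in> m"
      then have "x i \<in> Q (x ` underS m j)" using capture ij by blast
      moreover have "x j \<notin> Q (x ` underS m j)"
        using sep ij wo_rel.REFL[OF wo] unfolding refl_on_def by blast
      ultimately show False using ij by simp
    next
      assume "(j, i) \<in> m"
      then have "x j \<in> Q (x ` underS m i)" using capture ij by blast
      moreover have "x i \<notin> Q (x ` underS m i)"
        using sep ij wo_rel.REFL[OF wo] unfolding refl_on_def by blast
      ultimately show False using ij by simp
    qed
  qed
  define S where "S = x ` Field m"
  have "|Field m| =o |S|"
    using inj unfolding S_def by (intro card_of_ordIsoI[of x] inj_on_imp_bij_betw)
  moreover have "|Field m| =o m"
    using m card_of_Field_ordIso by blast
  ultimately have iso: "m =o |S|"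
    using ordIso_symmetric ordIso_transitive by blast
  have "regularCard |S|"
    using iso m by (rule regularCard_ordIso)
  moreover have "uncountable S"
    unfolding below using ordIso_symmetric[OF iso] not_ordLess_ordIso by blast
  moreover have SH: "S \<subseteq> H"
    using x by (auto simp: S_def)
  ultimately have "\<exists>p. complete_accumulation_point X S p"
    using X(1)[unfolded linearly_Lindelof_space_def, rule_format, of S] H by auto
  then obtain p where p: "complete_accumulation_point X S p" ..
  have large: "uncountable (U \<inter> S)" if "openin X U" "p \<in> U" for U
  proof -
    have "|U \<inter> S| =o |S|"
      using p that unfolding complete_accumulation_point_def by blast
    then have "|U \<inter> S| =o m"
      using iso ordIso_symmetric ordIso_transitive by blast
    then show ?thesis
      unfolding below using not_ordLess_ordIso by blast
  qed
  have "p \<in> X closure_of S"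
    unfolding in_closure_of
  proof (intro conjI allI impI, goal_cases)
    case 1
    show ?case using p by (simp add: complete_accumulation_point_def)
  next
    case (2 T)
    then have "T \<inter> S \<noteq> {}"
      using large[of T] by auto
    then show ?case by blast
  qed
  then obtain B where B: "B \<subseteq> S" "countable B" "p \<in> X closure_of B"
    using X(2)[unfolded countably_tight_space_def, rule_format, of S p] SH H by auto
  have "\<exists>i\<in>Field m. B \<subseteq> x ` under m i"
  proof (rule regularCard_UNION)
    show "Card_order m" "regularCard m" using m by simp_all
    show "relChain m (\<lambda>i. x ` under m i)"
      using wo_rel.TRANS[OF wo] unfolding relChain_def under_def trans_def by blast
    show "B \<subseteq> (\<Union>i\<in>Field m. x ` under m i)"
      using B(1) under_eq unfolding S_def by blast
    show "|B| <o m" using B below by blast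
  qed
  then obtain i where i: "i \<in> Field m" "B \<subseteq> x ` under m i" by blast
  \<comment> \<open>Neighbourhoods are assigned to strict segments, so a later \<open>j\<close> is
    taken to include the point at \<open>i\<close>.\<close>
  obtain j where j: "(i, j) \<in> m" "i \<noteq> j"
    using infinite_Card_order_limit[of m i] i m unfolding cinfinite_def by metis
  then have jF: "j \<in> Field m" by (auto simp: Field_def)
  have "under m i \<subseteq> underS m j"
    using j wo_rel.TRANS[OF wo] wo_rel.ANTISYM[OF wo]
    unfolding underS_def under_def trans_def antisym_def by blast
  then have "B \<subseteq> x ` underS m j"
    using i by blast
  then have "p \<in> X closure_of (x ` underS m j)"
    using B closure_of_mono by blast
  then have "p \<in> Q (x ` underS m j)" "openin X (Q (x ` underS m j))"
    using O[of "x ` underS m j"] initial[OF jF] by blast+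
  then have "uncountable (Q (x ` underS m j) \<inter> S)"
    using large by blast
  moreover have "Q (x ` underS m j) \<inter> S \<subseteq> x ` underS m j"
  proof
    fix z assume z: "z \<in> Q (x ` underS m j) \<inter> S"
    then obtain k where k: "k \<in> Field m" "z = x k" by (auto simp: S_def)
    have "(j, k) \<notin> m" using sep z k by blast
    then have "k \<in> underS m j"
      using wo_rel.TOTALS[OF wo] wo_rel.REFL[OF wo] k jF unfolding underS_def refl_on_def by blast
    then show "z \<in> x ` underS m j" using k by blast
  qed
  ultimately show False
    using initial[OF jF] countable_subset by blast
qed

section \<open>Closing off under operations on small sets\<close>

lemma cexp_ordLeq_of_cpow_less:
  assumes "Card_order \<rho>" "cpow_less \<rho> \<kappa> \<le>o \<rho>" "Card_order \<nu>" "\<nu> <o \<kappa>"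
  shows "\<rho> ^c \<nu> \<le>o \<rho>"
  using cpow_less_upper[OF assms(3,4,1)] assms(2) by (rule ordLeq_transitive)

text \<open>A nonempty small subset is the image of a function on a proper initial segment of
  \<open>\<kappa>\<close>. There are at most \<open>\<rho>\<close> segments, each carrying at most
  \<open>\<rho>\<close> functions into \<open>T\<close>.\<close>

lemma card_of_small_subsets:
  fixes \<kappa> :: "'k rel" and \<rho> :: "'r rel"
  assumes \<kappa>: "Card_order \<kappa>" and \<rho>: "Cinfinite \<rho>" and le: "\<kappa> \<le>o \<rho>"
    and pow: "cpow_less \<rho> \<kappa> \<le>o \<rho>"
    and T: "|T| \<le>o \<rho>"
  shows "|{S. S \<subseteq> T \<and> |S| <o \<kappa>}| \<le>o \<rho>"
proof -
  \<comment> \<open>The empty set is added by hand, since it is no image of a nonempty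
    segment.\<close>
  let ?F = "\<lambda>i. insert {} ((\<lambda>f. f ` underS \<kappa> i) ` Func (underS \<kappa> i) T)"
  have "{S. S \<subseteq> T \<and> |S| <o \<kappa>} \<subseteq> (\<Union>i\<in>Field \<kappa>. ?F i)"
  proof
    fix S assume S: "S \<in> {S. S \<subseteq> T \<and> |S| <o \<kappa>}"
    then obtain i where i: "i \<in> Field \<kappa>" "|S| \<le>o |underS \<kappa> i|"
      using ordLess_imp_ordLeq_underS[OF \<kappa>, of S] by blast
    show "S \<in> (\<Union>i\<in>Field \<kappa>. ?F i)"
    proof (cases "S = {}")
      case True
      then show ?thesis using i by blast
    next
      case False
      then obtain g where g: "g ` underS \<kappa> i = S"
        using i card_of_ordLeq2 by metis
      let ?g = "\<lambda>j. if j \<in> underS \<kappa> i then g j else undefined"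
      have "?g \<in> Func (underS \<kappa> i) T"
        using g S by (auto simp: Func_def)
      moreover have "?g ` underS \<kappa> i = S"
        using g by (auto simp: image_iff)
      ultimately have "S \<in> (\<lambda>f. f ` underS \<kappa> i) ` Func (underS \<kappa> i) T"
        by (intro image_eqI[of _ _ ?g]) simp_all
      then show ?thesis using i by blast
    qed
  qed
  moreover have "|\<Union>i\<in>Field \<kappa>. ?F i| \<le>o \<rho>"
  proof (rule UNION_Cinfinite_bound)
    show "|Field \<kappa>| \<le>o \<rho>"
      using card_of_Field_ordIso[OF \<kappa>] le by (rule ordIso_ordLeq_trans)
    show "Cinfinite \<rho>" by (rule \<rho>)
    show "\<forall>i\<in>Field \<kappa>. |?F i| \<le>o \<rho>"
    proof
      fix i assume i: "i \<in> Field \<kappa>"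
      have "|underS \<kappa> i| <o \<kappa>"
        using \<kappa> i by (rule card_of_underS)
      then have "\<rho> ^c |underS \<kappa> i| \<le>o \<rho>"
        using \<rho> pow by (intro cexp_ordLeq_of_cpow_less[of \<rho> \<kappa>] card_of_Card_order) simp_all
      moreover have "|Func (underS \<kappa> i) T| \<le>o \<rho> ^c |underS \<kappa> i|"
        using cexp_mono1[OF T card_of_Card_order, of "underS \<kappa> i"]
        by (simp add: cexp_def Field_card_of)
      ultimately have "|Func (underS \<kappa> i) T| \<le>o \<rho>"
        using ordLeq_transitive by blast
      then have "|(\<lambda>f. f ` underS \<kappa> i) ` Func (underS \<kappa> i) T| \<le>o \<rho>"
        by (rule ordLeq_transitive[OF card_of_image])
      moreover have "|{{}}| \<le>o \<rho>"
        using \<rho> by (intro Card_order_singl_ordLeq) (auto simp: cinfinite_def)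
      ultimately show "|?F i| \<le>o \<rho>"
        unfolding insert_is_Un[of "{}" "_ ` _"] using \<rho> by (intro Un_Cinfinite_bound)
    qed
  qed
  ultimately show ?thesis
    by (rule ordLeq_transitive[OF card_of_mono1])
qed

text \<open>Iterates \<open>\<Phi>\<close> along \<open>\<rho>\<close>, applying it at each stage to
  all small subsets of the earlier stages. A small subset of the union already lies in the stages
  below some \<open>i\<close>: its stage indices are bounded by Koenig's theorem, even if
  \<open>\<rho>\<close> is singular.\<close>

lemma closing_off:
  fixes \<kappa> :: "'k rel" and \<rho> :: "'r rel" and \<Phi> :: "'a set \<Rightarrow> 'a set"
  assumes \<kappa>: "Card_order \<kappa>" and \<rho>: "Cinfinite \<rho>" and le: "\<kappa> \<le>o \<rho>"
    and pow: "cpow_less \<rho> \<kappa> \<le>o \<rho>"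
    and \<Phi>: "\<And>S. |S| <o \<kappa> \<Longrightarrow> |\<Phi> S| \<le>o \<rho>"
  shows "\<exists>H. |H| \<le>o \<rho> \<and> (\<forall>S\<subseteq>H. |S| <o \<kappa> \<longrightarrow> \<Phi> S \<subseteq> H)"
proof -
  have wo: "wo_rel \<rho>"
    using \<rho> by (simp add: card_order_on_well_order_on wo_rel_def)
  have wf: "wf (\<rho> - Id)"
    using wo wo_rel.WF by blast
  define F where "F h i = \<Union>(\<Phi> ` {S. S \<subseteq> (\<Union>j\<in>underS \<rho> i. h j) \<and> |S| <o \<kappa>})"
    for h :: "'r \<Rightarrow> 'a set" and i
  define h where "h = wfrec (\<rho> - Id) F"
  have h: "h i = \<Union>(\<Phi> ` {S. S \<subseteq> (\<Union>j\<in>underS \<rho> i. h j) \<and> |S| <o \<kappa>})" for i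
  proof -
    have "h i = F (cut h (\<rho> - Id) i) i"
      unfolding h_def by (rule wfrec) (rule wf)
    moreover have "(\<Union>j\<in>underS \<rho> i. cut h (\<rho> - Id) i j) = (\<Union>j\<in>underS \<rho> i. h j)"
      by (rule SUP_cong) (auto simp: cut_apply underS_def)
    ultimately show ?thesis
      unfolding F_def by simp
  qed
  have field: "|Field \<rho>| \<le>o \<rho>"
    using \<rho> by (intro ordIso_imp_ordLeq card_of_Field_ordIso) simp
  have card_h: "|h i| \<le>o \<rho>" for i
  proof (induction i rule: wf_induct[OF wf])
    case (1 i)
    have "|underS \<rho> i| \<le>o \<rho>"
      using card_of_mono1[of "underS \<rho> i" "Field \<rho>"] field ordLeq_transitive
      by (fastforce simp: underS_def Field_def)
    moreover have "\<forall>j\<in>underS \<rho> i. |h j| \<le>o \<rho>"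
      using 1 by (auto simp: underS_def)
    ultimately have "|\<Union>j\<in>underS \<rho> i. h j| \<le>o \<rho>"
      using \<rho> by (intro UNION_Cinfinite_bound)
    then have "|{S. S \<subseteq> (\<Union>j\<in>underS \<rho> i. h j) \<and> |S| <o \<kappa>}| \<le>o \<rho>"
      using \<kappa> \<rho> le pow by (intro card_of_small_subsets)
    then show ?case
      unfolding h[of i] using \<rho> \<Phi> by (intro UNION_Cinfinite_bound) auto
  qed
  let ?H = "\<Union>i\<in>Field \<rho>. h i"
  have "|?H| \<le>o \<rho>"
    using field card_h \<rho> by (intro UNION_Cinfinite_bound) auto
  moreover have "\<Phi> S \<subseteq> ?H" if S: "S \<subseteq> ?H" "|S| <o \<kappa>" for S
  proof -
    have "\<forall>s\<in>S. \<exists>i\<in>Field \<rho>. s \<in> h i"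
      using S by blast
    then obtain f where f: "\<And>s. s \<in> S \<Longrightarrow> f s \<in> Field \<rho> \<and> s \<in> h (f s)"
      by metis
    have "|f ` S| <o \<kappa>"
      using card_of_image S(2) by (rule ordLeq_ordLess_trans)
    then have "\<rho> ^c |f ` S| \<le>o \<rho>"
      using \<rho> pow by (intro cexp_ordLeq_of_cpow_less[of \<rho> \<kappa>] card_of_Card_order) simp_all
    moreover have "f ` S \<subseteq> Field \<rho>"
      using f by blast
    ultimately obtain i where i: "i \<in> Field \<rho>" "f ` S \<subseteq> underS \<rho> i"
      using koenig_bounded[OF \<rho>, of "f ` S"] by blast
    then have "S \<subseteq> (\<Union>j\<in>underS \<rho> i. h j)"
      using f by blast
    then have "\<Phi> S \<subseteq> h i"
      using S(2) h[of i] by blast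
    then show ?thesis
      using i by blast
  qed
  ultimately show ?thesis
    by blast
qed

section \<open>Arithmetic of the continuum\<close>

lemma Cinfinite_continuum: "Cinfinite continuum"
  unfolding continuum_def
  by (rule Cinfinite_cexp[OF ordLeq_refl[OF Card_order_ctwo] natLeq_Cinfinite])

lemma natLeq_less_continuum: "natLeq <o continuum"
  unfolding continuum_def by (rule ordLess_ctwo_cexp[OF natLeq_Card_order])

lemma continuum_cexp_natLeq: "continuum ^c natLeq \<le>o continuum"
  unfolding continuum_def
  by (intro ordIso_imp_ordLeq cexp_cprod_ordLeq Card_order_ctwo natLeq_Cinfinite
      Cinfinite_Cnotzero ordLeq_refl natLeq_Card_order)

lemma Times_nat_ordLess_continuum:
  assumes "|S| <o continuum"
  shows "|S \<times> (UNIV :: nat set)| <o continuum"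
proof -
  have "|\<Union>n\<in>UNIV. (\<lambda>s. (s, n :: nat)) ` S| <o continuum"
    by (intro countable_UN_ordLess Cinfinite_continuum continuum_cexp_natLeq
        ordLeq_ordLess_trans[OF card_of_image assms]) simp
  moreover have "(\<Union>n\<in>UNIV. (\<lambda>s. (s, n :: nat)) ` S) = S \<times> UNIV"
    by auto
  ultimately show ?thesis
    by simp
qed

lemma countable_ordLess_continuum: "countable A \<Longrightarrow> |A| <o continuum"
  unfolding countable_iff_ordLeq_natLeq
  using ordLeq_ordLess_trans[OF _ natLeq_less_continuum] .

text \<open>Makes the continuum itself an admissible \<open>\<rho>\<close> under the hypothesis of
  the second half of the theorem.\<close>

lemma cpow_less_continuum:
  assumes "cpow_less ctwo continuum \<le>o continuum"
  shows "cpow_less continuum continuum \<le>o continuum"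
proof (rule cpow_less_least)
  show "Card_order continuum"
    using Cinfinite_continuum by simp
  fix \<nu> :: "(nat \<Rightarrow> bool) rel"
  assume \<nu>: "Card_order \<nu>" "\<nu> <o continuum"
  have "|Field \<nu>| <o continuum"
    by (rule ordIso_ordLess_trans[OF card_of_Field_ordIso[OF \<nu>(1)] \<nu>(2)])
  then have "|Field \<nu> \<times> (UNIV :: nat set)| <o continuum"
    by (rule Times_nat_ordLess_continuum)
  then have less: "natLeq *c \<nu> <o continuum"
    unfolding cprod_def Field_natLeq by (rule ordIso_ordLess_trans[OF card_of_Times_commute])
  \<comment> \<open>This holds for singular \<open>\<cc>\<close> too, because \<open>\<cc>\<close> is itself a power of 2.\<close>
  have "continuum ^c \<nu> =o ctwo ^c (natLeq *c \<nu>)"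
    unfolding continuum_def using Card_order_ctwo by (rule cexp_cprod)
  also have "ctwo ^c (natLeq *c \<nu>) \<le>o cpow_less ctwo continuum"
    using less Card_order_ctwo by (intro cpow_less_upper) (simp_all add: Card_order_cprod)
  also have "cpow_less ctwo continuum \<le>o continuum"
    by fact
  finally show "continuum ^c \<nu> \<le>o continuum" .
qed

section \<open>Lindeloef bounds for the modified topology\<close>

text \<open>The generating sets are closed under finite intersections, so they form a base.\<close>

lemma openin_Gdelta_modification_imp:
  assumes "openin (Gdelta_modification X) U" "y \<in> U"
  shows "\<exists>G. gdelta_in X G \<and> y \<in> G \<and> G \<subseteq> U"
proof -
  have "generate_topology_on {G. gdelta_in X G} U"
    using assms(1) unfolding Gdelta_modification_def by (rule openin_topology_generated_by)
  then show ?thesis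
    using assms(2)
  proof (induction arbitrary: y)
    case (Int a b)
    then obtain G H where "gdelta_in X G" "y \<in> G" "G \<subseteq> a" "gdelta_in X H" "y \<in> H" "H \<subseteq> b"
      by blast
    then show ?case
      by (intro exI[of _ "G \<inter> H"]) (auto intro: gdelta_in_Int)
  next
    case (UN K)
    then show ?case
      by (meson UnionE Union_upper order_trans)
  qed auto
qed

text \<open>Stated for every infinite \<open>\<rho>\<close> closed under powers below the continuum,
  so that \<open>rho continuum\<close> and \<open>continuum\<close> are both instances.\<close>

lemma Lindelof_bound_Gdelta_modification:
  fixes X :: "'a topology" and \<rho> :: "'r rel"
  assumes X: "regular_space X" "linearly_Lindelof_space X" "countably_tight_space X"
    and \<rho>: "Cinfinite \<rho>" "cpow_less \<rho> continuum \<le>o \<rho>"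
  shows "Lindelof_bound (Gdelta_modification X) \<rho>"
  unfolding Lindelof_bound_def topspace_Gdelta_modification
proof (intro allI impI, elim conjE)
  fix \<U>
  assume \<U>: "\<forall>U\<in>\<U>. openin (Gdelta_modification X) U" "\<Union>\<U> = topspace X"
  note pow = cexp_ordLeq_of_cpow_less[OF conjunct2[OF \<rho>(1)] \<rho>(2)]
  have c_le: "continuum \<le>o \<rho>"
  proof -
    have "continuum \<le>o \<rho> ^c natLeq"
      unfolding continuum_def
      by (intro cexp_mono1 ctwo_ordLeq_Cinfinite natLeq_Card_order \<rho>(1))
    also have "\<rho> ^c natLeq \<le>o \<rho>"
      using natLeq_Card_order natLeq_less_continuum by (rule pow)
    finally show ?thesis .
  qed
  have "\<exists>U (V :: nat \<Rightarrow> 'a set). U \<in> \<U> \<and> (\<forall>n. openin X (V n)) \<and> z \<in> (\<Inter>n. V n) \<and> (\<Inter>n. V n) \<subseteq> U"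
    if z: "z \<in> topspace X" for z
  proof -
    obtain U where U: "U \<in> \<U>" "z \<in> U"
      using z \<U> by blast
    then obtain G where G: "gdelta_in X G" "z \<in> G" "G \<subseteq> U"
      using openin_Gdelta_modification_imp[of X U z] \<U>(1) by blast
    obtain V :: "nat \<Rightarrow> 'a set" where "\<And>n. openin X (V n)" "(\<Inter>n. V n) = G"
      using G(1) unfolding gdelta_in_descending by metis
    then show ?thesis
      using U G by metis
  qed
  then obtain E and V :: "'a \<Rightarrow> nat \<Rightarrow> 'a set"
    where EV: "\<And>z. z \<in> topspace X \<Longrightarrow> E z \<in> \<U> \<and> (\<forall>n. openin X (V z n)) \<and> z \<in> (\<Inter>n. V z n) \<and> (\<Inter>n. V z n) \<subseteq> E z"
    by metis
  define G where "G z = (\<Inter>n. V z n)" for z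
  have G: "gdelta_in X (G z)" if "z \<in> topspace X" for z
    unfolding G_def using EV[OF that]
    by (intro gdelta_in_Inter) (auto intro: open_imp_gdelta_in)
  have z_in_G: "z \<in> G z" if "z \<in> topspace X" for z
    using EV[OF that] unfolding G_def by simp
  have "\<exists>Z\<subseteq>topspace X. |Z| \<le>o continuum \<and> X closure_of A \<subseteq> (\<Union>z\<in>Z. G z)"
    if A: "countable A \<and> A \<subseteq> topspace X" for A
  proof (rule Gdelta_subcover_closure_of_countable[OF X(1)])
    show "X closure_of A \<subseteq> (\<Union>z\<in>topspace X. G z)"
      using z_in_G closure_of_subset_topspace[of X A] by blast
  qed (use A G in auto)
  then have "\<forall>A\<in>{A. countable A \<and> A \<subseteq> topspace X}. \<exists>Z. Z \<subseteq> topspace X \<and> |Z| \<le>o continuum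
      \<and> X closure_of A \<subseteq> (\<Union>z\<in>Z. G z)"
    by simp
  then obtain Z where "\<forall>A\<in>{A. countable A \<and> A \<subseteq> topspace X}. Z A \<subseteq> topspace X \<and> |Z A| \<le>o continuum
      \<and> X closure_of A \<subseteq> (\<Union>z\<in>Z A. G z)"
    unfolding bchoice_iff ..
  then have Z: "Z A \<subseteq> topspace X \<and> |Z A| \<le>o continuum \<and> X closure_of A \<subseteq> (\<Union>z\<in>Z A. G z)"
    if "countable A \<and> A \<subseteq> topspace X" for A
    using that by simp
  \<comment> \<open>A point missed by the sets indexed by \<open>P\<close>; unspecified if they
    cover the space.\<close>
  define w where "w P = (SOME y. y \<in> topspace X \<and> y \<notin> (\<Union>(z, n)\<in>P. V z n))" for P
  \<comment> \<open>The first part supplies indices covering the closure of a countable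
    \<open>S\<close>; the second supplies missed points for every subfamily with indices in
    \<open>S\<close>.\<close>
  define \<Phi> where "\<Phi> S = (if countable S \<and> S \<subseteq> topspace X then Z S else {}) \<union> w ` Pow (S \<times> UNIV)" for S
  have "|\<Phi> S| \<le>o \<rho>" if S: "|S| <o continuum" for S
  proof -
    have "|Z S| \<le>o \<rho>" if "countable S \<and> S \<subseteq> topspace X"
      using Z[OF that] by (intro ordLeq_transitive[OF _ c_le]) simp
    then have 1: "|if countable S \<and> S \<subseteq> topspace X then Z S else {}| \<le>o \<rho>"
      by (auto intro: Card_order_empty[OF conjunct2[OF \<rho>(1)]])
    \<comment> \<open>Multiplying by \<open>nat\<close> keeps the exponent below the continuum, so
      the powerset still has size at most \<open>\<rho>\<close>.\<close>
    have "|Pow (S \<times> (UNIV :: nat set))| =o ctwo ^c |S \<times> (UNIV :: nat set)|"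
      unfolding cexp_def ctwo_def Field_card_of by (rule card_of_Pow_Func)
    also have "ctwo ^c |S \<times> (UNIV :: nat set)| \<le>o \<rho> ^c |S \<times> (UNIV :: nat set)|"
      by (intro cexp_mono1 ctwo_ordLeq_Cinfinite card_of_Card_order \<rho>(1))
    also have "\<rho> ^c |S \<times> (UNIV :: nat set)| \<le>o \<rho>"
      by (intro pow card_of_Card_order Times_nat_ordLess_continuum S)
    finally have 2: "|w ` Pow (S \<times> (UNIV :: nat set))| \<le>o \<rho>"
      by (rule ordLeq_transitive[OF card_of_image])
    show ?thesis
      unfolding \<Phi>_def using 1 2 \<rho>(1) by (rule Un_Cinfinite_bound)
  qed
  then obtain H0 where H0: "|H0| \<le>o \<rho>" "\<forall>S\<subseteq>H0. |S| <o continuum \<longrightarrow> \<Phi> S \<subseteq> H0"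
    using closing_off[OF conjunct2[OF Cinfinite_continuum] \<rho>(1) c_le \<rho>(2), of \<Phi>] by blast
  \<comment> \<open>Discards unspecified values of \<open>w\<close> that may lie outside the
    space.\<close>
  define H where "H = H0 \<inter> topspace X"
  have card_H: "|H| \<le>o \<rho>"
    unfolding H_def by (rule ordLeq_transitive[OF card_of_mono1 H0(1)]) simp
  have H_sub: "H \<subseteq> topspace X"
    by (simp add: H_def)
  have Z_sub: "Z A \<subseteq> H" if "A \<subseteq> H" "countable A" for A
    using H0(2)[rule_format, of A] that Z[of A] countable_ordLess_continuum[of A]
    unfolding H_def \<Phi>_def by auto
  have "topspace X \<subseteq> (\<Union>z\<in>H. G z)"
  proof (rule ccontr)
    assume "\<not> ?thesis"
    then obtain x where x: "x \<in> topspace X" "\<And>z. z \<in> H \<Longrightarrow> x \<notin> G z"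
      by blast
    then obtain n where n: "\<And>z. z \<in> H \<Longrightarrow> x \<notin> V z (n z)"
      unfolding G_def INT_iff by metis
    define Q where "Q z = V z (n z)" for z
    have Q: "openin X (Q z)" "G z \<subseteq> Q z" if "z \<in> H" for z
      using EV[of z] that H_sub unfolding Q_def G_def by blast+
    \<comment> \<open>The point \<open>x\<close> lies outside all these sets, so \<open>w\<close>
      picks a genuinely missed point, and closure under \<open>\<Phi>\<close> puts that point in
      \<open>H\<close>.\<close>
    have no_cover: "\<not> H \<subseteq> (\<Union>z\<in>J. Q z)" if J: "J \<subseteq> H" "|J| <o continuum" for J
    proof -
      let ?P = "(\<lambda>z. (z, n z)) ` J"
      have "x \<in> topspace X \<and> x \<notin> (\<Union>(z, n)\<in>?P. V z n)"
        using x(1) n J by auto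
      then have "w ?P \<in> topspace X \<and> w ?P \<notin> (\<Union>(z, n)\<in>?P. V z n)"
        unfolding w_def by (rule someI)
      then have w: "w ?P \<in> topspace X" "w ?P \<notin> (\<Union>z\<in>J. Q z)"
        unfolding Q_def by auto
      have "w ?P \<in> \<Phi> J"
        unfolding \<Phi>_def by blast
      moreover have "\<Phi> J \<subseteq> H0"
        using H0(2) J unfolding H_def by blast
      ultimately show ?thesis
        using w unfolding H_def by blast
    qed
    have "\<exists>J\<subseteq>Z A. |J| <o continuum \<and> X closure_of A \<subseteq> (\<Union>z\<in>J. Q z)"
      if A: "A \<subseteq> H" "countable A" for A
    proof (rule linearly_Lindelof_ordLess_subcover[OF X(2)])
      have ZA: "|Z A| \<le>o continuum" "X closure_of A \<subseteq> (\<Union>z\<in>Z A. G z)"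
        using Z[of A] A H_sub by auto
      then show "X closure_of A \<subseteq> (\<Union>z\<in>Z A. Q z)"
        using Q(2) Z_sub[OF A] by blast
      show "|Z A| \<le>o continuum" by fact
      show "openin X (Q z)" if "z \<in> Z A" for z
        using that Q(1) Z_sub[OF A] by blast
    qed (simp_all add: Cinfinite_continuum continuum_cexp_natLeq)
    then obtain J where J: "\<And>A. A \<subseteq> H \<Longrightarrow> countable A \<Longrightarrow>
        J A \<subseteq> Z A \<and> |J A| <o continuum \<and> X closure_of A \<subseteq> (\<Union>z\<in>J A. Q z)"
      by metis
    have "\<exists>\<A>. countable \<A> \<and> (\<forall>A\<in>\<A>. A \<subseteq> H \<and> countable A) \<and> H \<subseteq> (\<Union>A\<in>\<A>. \<Union>z\<in>J A. Q z)"
    proof (rule countable_cover_by_closure_neighbourhoods[OF X(2,3) H_sub])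
      fix A assume A: "A \<subseteq> H" "countable A"
      then show "openin X (\<Union>z\<in>J A. Q z) \<and> X closure_of A \<subseteq> (\<Union>z\<in>J A. Q z)"
        using J[OF A] Q(1) Z_sub[OF A] by blast
    qed
    then obtain \<A> where \<A>: "countable \<A>" "\<forall>A\<in>\<A>. A \<subseteq> H \<and> countable A"
      "H \<subseteq> (\<Union>A\<in>\<A>. \<Union>z\<in>J A. Q z)"
      by (elim exE conjE)
    \<comment> \<open>Countably many families smaller than the continuum stay below it in union, by
      uncountable cofinality; this meets \<open>no_cover\<close>.\<close>
    have "|\<Union>A\<in>\<A>. J A| <o continuum"
      using \<A> J by (intro countable_UN_ordLess Cinfinite_continuum continuum_cexp_natLeq) auto
    moreover have "(\<Union>A\<in>\<A>. J A) \<subseteq> H"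
    proof (rule UN_least)
      fix A assume "A \<in> \<A>"
      then have A: "A \<subseteq> H" "countable A" using \<A>(2) by simp_all
      then show "J A \<subseteq> H" using J[OF A] Z_sub[OF A] by blast
    qed
    ultimately show False
      using no_cover[of "\<Union>A\<in>\<A>. J A"] \<A>(3) by auto
  qed
  moreover have "G z \<subseteq> E z" "E z \<in> \<U>" if "z \<in> H" for z
    using EV[of z] that H_sub unfolding G_def by blast+
  ultimately have "topspace X \<subseteq> \<Union>(E ` H)" "E ` H \<subseteq> \<U>"
    by blast+
  then show "\<exists>\<V>. \<V> \<subseteq> \<U> \<and> |\<V>| \<le>o \<rho> \<and> \<Union>\<V> = topspace X"
    using \<U>(2) ordLeq_transitive[OF card_of_image card_H, of E]
    by (intro exI[of _ "E ` H"]) blast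
qed

text \<open>Without a complete accumulation point, the open sets meeting \<open>A\<close> in fewer
  than \<open>|A|\<close> points cover \<open>Y\<close>. At most \<open>\<mu>\<close> of them
  suffice, which writes \<open>A\<close> as a union of fewer than \<open>|A|\<close> smaller sets,
  against regularity.\<close>

lemma Lindelof_bound_imp_linear_Lindelof_bound:
  assumes \<mu>: "Cinfinite \<mu>" "Lindelof_bound Y \<mu>"
  shows "linear_Lindelof_bound Y \<mu>"
  unfolding linear_Lindelof_bound_def
proof (intro allI impI, elim conjE, rule ccontr)
  fix A assume A: "A \<subseteq> topspace Y" "\<mu> <o |A|" "regularCard |A|"
    and neg: "\<not> (\<exists>p. complete_accumulation_point Y A p)"
  have inf: "Cinfinite |A|"
    using \<mu>(1) by (intro conjI cinfinite_mono[OF ordLess_imp_ordLeq[OF A(2)]] card_of_Card_order) simp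
  let ?\<U> = "{U. openin Y U \<and> |U \<inter> A| <o |A|}"
  have "p \<in> \<Union>?\<U>" if p: "p \<in> topspace Y" for p
  proof -
    obtain U where "openin Y U" "p \<in> U" "\<not> |U \<inter> A| =o |A|"
      using neg p unfolding complete_accumulation_point_def by blast
    moreover have "|U \<inter> A| \<le>o |A|"
      by (rule card_of_mono1) simp
    ultimately show ?thesis
      using ordLeq_iff_ordLess_or_ordIso by blast
  qed
  then have "(\<forall>U\<in>?\<U>. openin Y U) \<and> \<Union>?\<U> = topspace Y"
    using openin_subset by auto
  from \<mu>(2)[unfolded Lindelof_bound_def, rule_format, OF this]
  obtain \<V> where \<V>: "\<V> \<subseteq> ?\<U>" "|\<V>| \<le>o \<mu>" "\<Union>\<V> = topspace Y"
    by (elim exE conjE)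
  have "|\<Union>U\<in>\<V>. U \<inter> A| <o |A|"
    using \<V>(1) by (intro regularCard_UNION_bound inf A(3) ordLeq_ordLess_trans[OF \<V>(2) A(2)]) auto
  moreover have "(\<Union>U\<in>\<V>. U \<inter> A) = A"
    using \<V>(3) A(1) by auto
  ultimately show False
    using ordLess_irreflexive[of "|A|"] by simp
qed

theorem corollary0p2:
  fixes X :: "'a topology"
  assumes "regular_space X" and "Hausdorff_space X"
    and "linearly_Lindelof_space X"
    and "countably_tight_space X"
  shows "linear_Lindelof_number (Gdelta_modification X) \<le>o Lindelof_number (Gdelta_modification X) \<and>
      Lindelof_number (Gdelta_modification X) \<le>o rho continuum \<and>
      (continuum =o cpow_less ctwo continuum \<longrightarrow>
        linear_Lindelof_number (Gdelta_modification X) \<le>o Lindelof_number (Gdelta_modification X) \<and>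
        Lindelof_number (Gdelta_modification X) \<le>o continuum)"
proof (intro conjI impI)
  show linear: "linear_Lindelof_number (Gdelta_modification X) \<le>o Lindelof_number (Gdelta_modification X)"
    by (intro linear_Lindelof_number_le Lindelof_bound_imp_linear_Lindelof_bound
        Lindelof_number_works)
  then show "linear_Lindelof_number (Gdelta_modification X) \<le>o Lindelof_number (Gdelta_modification X)" .
  show "Lindelof_number (Gdelta_modification X) \<le>o rho continuum"
    by (intro Lindelof_number_le Lindelof_bound_Gdelta_modification assms
        rho_works[OF Cinfinite_continuum] ordIso_imp_ordLeq)
  assume "continuum =o cpow_less ctwo continuum"
  then have "cpow_less continuum continuum \<le>o continuum"
    by (intro cpow_less_continuum ordIso_imp_ordLeq[OF ordIso_symmetric])
  then show "Lindelof_number (Gdelta_modification X) \<le>o continuum"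
    by (intro Lindelof_number_le Lindelof_bound_Gdelta_modification assms Cinfinite_continuum)
qed

end
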